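(* Let $t$ be a positive integer, and let $F$ be a forest whose size (number of edges) satisfies $m(F)<\frac{1}{6}\left(t^3+6t^2+17t+12\right)$. Then $f_2(F)\leq t$.
   Context: All graphs are finite, simple, and undirected. For a graph $G$, $n(G)$ denotes its order (number of vertices) and $m(G)$ its size (number of edges). For an integer $k\geq 2$ and a graph $G$, $f_k(G)$ is the minimum cardinality of a set $X$ of vertices of $G$ such that $G-X$ (the graph obtained by deleting $X$) either has at least $k$ vertices whose degree in $G-X$ equals the maximum degree of $G-X$, or has order less than $k$. *)

theory Defs
  imports Complex_Main "Graph_Theory.Graph_Theory"
begin

text \<open>
  A finite simple undirected graph is a \<open>graph\<close> of the library: a finite, loop-free symmetric
  digraph without multiple arcs, i.e. every edge \<open>uv\<close> is a pair of opposite arcs.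
  The degree of a vertex is therefore its \<open>out_degree\<close>.
\<close>

definition graph_size :: "('a, 'b) pre_digraph \<Rightarrow> nat" where
  "graph_size G = card ((\<lambda>e. {tail G e, head G e}) ` arcs G)"

text \<open>
  The library's \<open>cycle\<close> also admits the closed walk \<open>u, v, u\<close> along the two arcs of one edge
  (so the library's \<open>forest\<close> is not the undirected notion); the cycles of a
  simple graph are those of length at least 3.
\<close>
definition undirected_forest :: "('a, 'b) pre_digraph \<Rightarrow> bool" where
  "undirected_forest G \<longleftrightarrow> graph G \<and> \<not> (\<exists>p. pre_digraph.cycle G p \<and> 3 \<le> length p)"

definition delete_verts :: "('a, 'b) pre_digraph \<Rightarrow> 'a set \<Rightarrow> ('a, 'b) pre_digraph" where
  "delete_verts G X = G \<restriction> (verts G - X)"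

text \<open>Only meaningful for graphs with at least one vertex.\<close>
definition max_degree :: "('a, 'b) pre_digraph \<Rightarrow> nat" where
  "max_degree G = Max (out_degree G ` verts G)"

definition max_degree_verts :: "('a, 'b) pre_digraph \<Rightarrow> 'a set" where
  "max_degree_verts G = {v \<in> verts G. out_degree G v = max_degree G}"

text \<open>For \<open>k \<ge> 1\<close> the minimum exists, since \<open>X = verts G\<close> is always admissible.\<close>
definition f_num :: "nat \<Rightarrow> ('a, 'b) pre_digraph \<Rightarrow> nat" where
  "f_num k G = (LEAST n. \<exists>X \<subseteq> verts G. card X = n \<and>
     (k \<le> card (max_degree_verts (delete_verts G X)) \<or> card (verts (delete_verts G X)) < k))"

end

theory Submission
  imports Defs
begin

text \<open>
  Suppose that no set of at most \<open>t\<close> vertices can be deleted so as to leave two vertices of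
  maximum degree (or fewer than two vertices). Then there is a unique vertex \<open>v\<close> of maximum
  degree; let \<open>u\<close> be a vertex of second-largest degree, which is at least 1. At most one
  neighbour of \<open>v\<close> is \<open>u\<close> itself or a neighbour of \<open>u\<close>, because a forest has no
  cycle of length 3 or 4 (the locale \<open>no_short_cycles\<close> isolates this), so \<open>v\<close> has at
  least \<open>deg v - 1\<close> neighbours whose deletion lowers its degree by one each and leaves the
  degree of \<open>u\<close> alone. Deleting \<open>deg v - deg u\<close> of them makes \<open>u\<close> and
  \<open>v\<close> share the maximum degree (\<open>tied_after_deleting_nbrs\<close>), whence
  \<open>deg v - deg u \<ge> t + 1\<close>.

  Deleting \<open>v\<close> instead leaves a forest that no set of at most \<open>t - 1\<close> vertices can
  tie, and whose maximum degree is at most \<open>deg u\<close>. So, writing \<open>d t\<close> for the least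
  possible maximum degree in this situation, \<open>d 0 \<ge> 2\<close> and
  \<open>d t \<ge> d (t - 1) + t + 1\<close>, that is, \<open>d t \<ge> (t + 2 choose 2) + 1\<close>. The vertices
  deleted one after the other account for at least \<open>d t + d (t - 1) + \<dots> + d 0\<close> edges, and the sum
  of the lower bounds is \<open>(t + 3 choose 3) + t + 1\<close>
  (\<open>degree_and_edges_of_hard_to_tie\<close>), which is exactly the cubic polynomial of the
  hypothesis (\<open>choose_bound_eq\<close>).
\<close>

section \<open>Tied vertex sets of a graph without short cycles\<close>

text \<open>
  Throughout, a graph is an adjacency relation \<open>E\<close> that stays fixed, and its induced subgraphs
  are represented by their vertex sets \<open>S\<close>, so that deleting vertices is set difference.
\<close>

definition nbrs :: "('a \<Rightarrow> 'a \<Rightarrow> bool) \<Rightarrow> 'a set \<Rightarrow> 'a \<Rightarrow> 'a set" where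
  "nbrs E S v = {w \<in> S. E v w}"

definition edges :: "('a \<Rightarrow> 'a \<Rightarrow> bool) \<Rightarrow> 'a set \<Rightarrow> 'a set set" where
  "edges E S = {{u, w} | u w. u \<in> S \<and> w \<in> S \<and> E u w}"

text \<open>
  The condition that \<open>f_num 2\<close> imposes on what remains after a deletion, here for the
  subgraph induced by \<open>S\<close>.
\<close>
definition tied :: "('a \<Rightarrow> 'a \<Rightarrow> bool) \<Rightarrow> 'a set \<Rightarrow> bool" where
  "tied E S \<longleftrightarrow> card S < 2 \<or>
     (\<exists>u\<in>S. \<exists>v\<in>S. u \<noteq> v \<and> card (nbrs E S u) = card (nbrs E S v) \<and>
        (\<forall>w\<in>S. card (nbrs E S w) \<le> card (nbrs E S u)))"

lemma finite_nbrs: "finite S \<Longrightarrow> finite (nbrs E S v)"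
  by (simp add: nbrs_def)

lemma card_nbrs_mono: "finite S \<Longrightarrow> T \<subseteq> S \<Longrightarrow> card (nbrs E T v) \<le> card (nbrs E S v)"
  by (rule card_mono) (auto simp: nbrs_def)

lemma finite_edges: "finite S \<Longrightarrow> finite (edges E S)"
  by (rule finite_subset[of _ "Pow S"]) (auto simp: edges_def)

locale no_short_cycles =
  fixes E :: "'a \<Rightarrow> 'a \<Rightarrow> bool"
  assumes sym: "E a b \<Longrightarrow> E b a"
    and no_triangle: "E a b \<Longrightarrow> E b c \<Longrightarrow> E c a \<Longrightarrow> False"
    and no_4_cycle: "E a b \<Longrightarrow> E b c \<Longrightarrow> E c d \<Longrightarrow> E d a \<Longrightarrow> a \<noteq> c \<Longrightarrow> b \<noteq> d \<Longrightarrow> False"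
begin

text \<open>A loop would be a degenerate triangle.\<close>
lemma irrefl: "\<not> E a a"
  using no_triangle by blast

lemma card_edges_remove:
  assumes "finite S" "v \<in> S"
  shows "card (edges E S) = card (edges E (S - {v})) + card (nbrs E S v)"
proof -
  let ?star = "(\<lambda>w. {v, w}) ` nbrs E S v"
  have "edges E S = edges E (S - {v}) \<union> ?star"
  proof
    show "edges E S \<subseteq> edges E (S - {v}) \<union> ?star"
    proof
      fix e assume "e \<in> edges E S"
      then obtain a b where e: "e = {a, b}" "a \<in> S" "b \<in> S" "E a b"
        by (auto simp: edges_def)
      show "e \<in> edges E (S - {v}) \<union> ?star"
      proof (cases "a = v \<or> b = v")
        case True
        then show ?thesis using e sym by (auto simp: nbrs_def insert_commute)
      next
        case False
        then show ?thesis using e by (auto simp: edges_def)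
      qed
    qed
    show "edges E (S - {v}) \<union> ?star \<subseteq> edges E S"
      using \<open>v \<in> S\<close> by (auto simp: edges_def nbrs_def)
  qed
  moreover have "\<Union> (edges E (S - {v})) \<subseteq> S - {v}"
    by (auto simp: edges_def)
  then have "edges E (S - {v}) \<inter> ?star = {}" by blast
  moreover have "card ?star = card (nbrs E S v)"
    by (rule card_image) (auto simp: inj_on_def doubleton_eq_iff)
  ultimately show ?thesis
    using assms(1) by (simp add: card_Un_disjoint finite_edges finite_nbrs)
qed

text \<open>
  Two elements of the intersection would close a triangle through \<open>u\<close> and \<open>v\<close> if one of
  them is \<open>u\<close>, and a 4-cycle through \<open>u\<close> and \<open>v\<close> otherwise.
\<close>
lemma card_shared_nbrs_le_1:
  assumes "u \<noteq> v"
  shows "card (nbrs E S v \<inter> (insert u (nbrs E S u))) \<le> 1"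
proof -
  have "w = w'" if "E v w" "E v w'" "w = u \<or> E u w" "w' = u \<or> E u w'" for w w'
    using that assms sym no_triangle no_4_cycle by metis
  then have "\<forall>w \<in> nbrs E S v \<inter> (insert u (nbrs E S u)).
      \<forall>w' \<in> nbrs E S v \<inter> (insert u (nbrs E S u)). w = w'"
    by (auto simp: nbrs_def)
  then show ?thesis
    by (metis card.infinite card_le_Suc0_iff_eq One_nat_def zero_le_one)
qed

text \<open>
  The vertices to delete are neighbours of \<open>v\<close> outside the closed neighbourhood of
  \<open>u\<close>: each costs \<open>v\<close> one degree and \<open>u\<close> none, and the other degrees can only
  drop. Since \<open>deg u \<ge> 1\<close>, losing the one shared neighbour still leaves
  \<open>deg v - 1 \<ge> deg v - deg u\<close> candidates.
\<close>
lemma tied_after_deleting_nbrs: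
  assumes fin: "finite S" and vu: "v \<in> S" "u \<in> S" "u \<noteq> v"
    and deg: "1 \<le> card (nbrs E S u)" "card (nbrs E S u) \<le> card (nbrs E S v)"
    and second: "\<And>w. w \<in> S - {v} \<Longrightarrow> card (nbrs E S w) \<le> card (nbrs E S u)"
  shows "\<exists>W \<subseteq> S. card W = card (nbrs E S v) - card (nbrs E S u) \<and> tied E (S - W)"
proof -
  let ?d = "\<lambda>w. card (nbrs E S w)"
  let ?free = "nbrs E S v - insert u (nbrs E S u)"
  have "?d v \<le> card ?free + card (nbrs E S v \<inter> insert u (nbrs E S u))"
    using finite_nbrs[OF fin, of E v]
    by (metis card_Diff_subset_Int card_mono diff_le_mono2 finite_Int inf_le1
        le_add_diff_inverse2 order_refl)
  then have "?d v - ?d u \<le> card ?free"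
    using card_shared_nbrs_le_1[OF vu(3), of S] deg by linarith
  then obtain W where W: "W \<subseteq> ?free" "card W = ?d v - ?d u" "finite W"
    by (rule obtain_subset_with_card_n)
  have WS: "W \<subseteq> S" using W(1) by (auto simp: nbrs_def)
  have "v \<notin> W" "u \<notin> W" using W(1) irrefl by (auto simp: nbrs_def)
  have "nbrs E (S - W) u = nbrs E S u" using W(1) by (auto simp: nbrs_def)
  moreover have "nbrs E (S - W) v = nbrs E S v - W" by (auto simp: nbrs_def)
  moreover have "card (nbrs E S v - W) = ?d v - card W"
    using W by (intro card_Diff_subset) auto
  ultimately have degs: "card (nbrs E (S - W) u) = ?d u" "card (nbrs E (S - W) v) = ?d u"
    using W(2) deg(2) by auto
  have "card (nbrs E (S - W) w) \<le> ?d u" if "w \<in> S - W" for w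
  proof (cases "w = v")
    case False
    then show ?thesis
      using that second[of w] card_nbrs_mono[OF fin, of "S - W" E w] by auto
  qed (use degs in auto)
  then have "tied E (S - W)"
    unfolding tied_def using vu \<open>v \<notin> W\<close> \<open>u \<notin> W\<close> degs by (metis DiffI)
  then show ?thesis using WS W(2) by blast
qed

section \<open>Lower bounds for graphs that are hard to tie\<close>

text \<open>
  The second-largest degree is positive because \<open>v\<close>, having larger degree than some vertex,
  has a neighbour, and that neighbour has degree at least 1.
\<close>
lemma top_two_degrees:
  assumes fin: "finite S" and "\<not> tied E S"
  obtains v u where "v \<in> S" "u \<in> S" "u \<noteq> v"
    "1 \<le> card (nbrs E S u)" "card (nbrs E S u) < card (nbrs E S v)"
    "\<And>w. w \<in> S - {v} \<Longrightarrow> card (nbrs E S w) \<le> card (nbrs E S u)"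
proof -
  let ?d = "\<lambda>w. card (nbrs E S w)"
  have "2 \<le> card S" using assms(2) by (auto simp: tied_def)
  then have "S \<noteq> {}" by auto
  then obtain v where v: "v \<in> S" "\<And>w. w \<in> S \<Longrightarrow> ?d w \<le> ?d v"
    using obtains_MAX[OF fin, of ?d] fin by (metis Max_ge finite_imageI imageI)
  have "S - {v} \<noteq> {}" using \<open>2 \<le> card S\<close>
    by (metis card.empty card_Suc_Diff1 fin v(1) One_nat_def not_less_eq_eq numeral_2_eq_2 order_refl)
  then obtain u where u: "u \<in> S - {v}" "\<And>w. w \<in> S - {v} \<Longrightarrow> ?d w \<le> ?d u"
    using obtains_MAX[of "S - {v}" ?d] fin by (metis Max_ge finite_imageI imageI finite_Diff)
  have less: "?d u < ?d v"
    using assms(2) u v by (metis DiffE insertI1 le_neq_implies_less tied_def)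
  then have "nbrs E S v \<noteq> {}" by auto
  then obtain w where w: "w \<in> S" "E v w" by (auto simp: nbrs_def)
  then have "v \<in> nbrs E S w" "w \<in> S - {v}" using v sym irrefl by (auto simp: nbrs_def)
  then have "1 \<le> ?d w" using finite_nbrs[OF fin, of E w]
    by (metis One_nat_def Suc_leI card_gt_0_iff empty_iff)
  then have "1 \<le> ?d u" using u(2)[OF \<open>w \<in> S - {v}\<close>] by linarith
  then show thesis using that[of v u] u v less by auto
qed

text \<open>
  The two bounds are proved together: the degree bound feeds on itself through
  \<open>deg v \<ge> deg u + t + 1\<close>, and the edge bound adds the degree of the deleted vertex \<open>v\<close>
  to the edge bound for \<open>S - {v}\<close>. Both sums telescope by Pascal's rule.
\<close>
lemma degree_and_edges_of_hard_to_tie: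
  assumes "finite S" and "\<And>X. X \<subseteq> S \<Longrightarrow> card X \<le> t \<Longrightarrow> \<not> tied E (S - X)"
  shows "(\<exists>v\<in>S. (t + 2 choose 2) + 1 \<le> card (nbrs E S v)) \<and>
         (t + 3 choose 3) + t + 1 \<le> card (edges E S)"
  using assms
proof (induction t arbitrary: S)
  case 0
  then have "\<not> tied E S" by (metis Diff_empty card.empty empty_subsetI order_refl)
  then obtain v u where v: "v \<in> S" "1 \<le> card (nbrs E S u)" "card (nbrs E S u) < card (nbrs E S v)"
    using top_two_degrees[OF 0(1)] by metis
  then have "2 \<le> card (nbrs E S v)" by linarith
  then show ?case using v(1) card_edges_remove[OF 0(1) v(1)] by (auto simp: numeral_eq_Suc)
next
  case (Suc t)
  note fin = \<open>finite S\<close>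
  let ?d = "\<lambda>w. card (nbrs E S w)"
  have "\<not> tied E S" using Suc.prems(2)[of "{}"] by simp
  then obtain v u where v: "v \<in> S" "u \<in> S" "u \<noteq> v" "1 \<le> ?d u" "?d u < ?d v"
      "\<And>w. w \<in> S - {v} \<Longrightarrow> ?d w \<le> ?d u"
    using top_two_degrees[OF fin] by metis
  \<comment> \<open>Spending one deletion on \<open>v\<close> leaves \<open>t\<close> deletions for the rest.\<close>
  have "\<not> tied E (S - {v} - X)" if "X \<subseteq> S - {v}" "card X \<le> t" for X
  proof -
    have "v \<notin> X" "finite X" using that(1) fin by (auto intro: finite_subset)
    then have "card (insert v X) \<le> Suc t" using that(2) by simp
    moreover have "S - {v} - X = S - insert v X" by auto
    ultimately show ?thesis using Suc.prems(2)[of "insert v X"] that v(1) by auto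
  qed
  then have IH: "\<exists>x\<in>S - {v}. (t + 2 choose 2) + 1 \<le> card (nbrs E (S - {v}) x)"
      "(t + 3 choose 3) + t + 1 \<le> card (edges E (S - {v}))"
    using Suc.IH[of "S - {v}"] fin by auto
  then obtain x where "x \<in> S - {v}" "(t + 2 choose 2) + 1 \<le> card (nbrs E (S - {v}) x)"
    by blast
  then have "(t + 2 choose 2) + 1 \<le> ?d u"
    using v(6)[of x] card_nbrs_mono[OF fin, of "S - {v}" E x] by auto
  \<comment> \<open>Otherwise deleting at most \<open>t + 1\<close> neighbours of \<open>v\<close> would tie \<open>u\<close> and \<open>v\<close>.\<close>
  moreover have "t + 2 \<le> ?d v - ?d u"
  proof (rule ccontr)
    assume "\<not> t + 2 \<le> ?d v - ?d u"
    then show False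
      using tied_after_deleting_nbrs[OF fin v(1-4) less_imp_le[OF v(5)] v(6)] Suc.prems(2)
      by (metis add_2_eq_Suc' not_less_eq_eq)
  qed
  moreover have "(Suc t + 2 choose 2) = (t + 2 choose 2) + (t + 2)"
    by (simp add: numeral_eq_Suc)
  ultimately have deg: "(Suc t + 2 choose 2) + 1 \<le> ?d v" by linarith
  have "(Suc t + 3 choose 3) = (t + 3 choose 3) + (Suc t + 2 choose 2)"
    by (simp add: numeral_eq_Suc)
  then show ?case
    using deg v(1) IH(2) card_edges_remove[OF fin v(1)] by auto
qed

end

lemma choose_bound_eq:
  "real ((t + 3 choose 3) + t + 1) = 1 / 6 * (real t ^ 3 + 6 * real t ^ 2 + 17 * real t + 12)"
proof -
  have two: "2 * real (t + 2 choose 2) = (real t + 2) * (real t + 1)" for t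
  proof (induction t)
    case (Suc t)
    have "(Suc t + 2 choose 2) = (t + 2 choose 2) + (t + 2)"
      by (simp add: numeral_eq_Suc)
    then show ?case using Suc by (simp add: algebra_simps)
  qed (simp add: numeral_eq_Suc)
  have "6 * real (t + 3 choose 3) = (real t + 3) * (real t + 2) * (real t + 1)"
  proof (induction t)
    case (Suc t)
    have "(Suc t + 3 choose 3) = (t + 3 choose 3) + (Suc t + 2 choose 2)"
      by (simp add: numeral_eq_Suc)
    then show ?case using Suc two[of "Suc t"] by (simp add: algebra_simps)
  qed (simp add: numeral_eq_Suc)
  then show ?thesis by (simp add: algebra_simps power2_eq_square power3_eq_cube)
qed

section \<open>Transfer to digraph-based forests\<close>

lemma undirected_forest_no_short_cycles:
  assumes "undirected_forest F"
  shows "no_short_cycles (dominates F)"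
proof -
  interpret graph F using assms by (simp add: undirected_forest_def)
  have acyclic: "length p < 3" if "cycle p" for p
    using assms that by (auto simp: undirected_forest_def not_less)
  show ?thesis
  proof
    fix a b assume "a \<rightarrow>\<^bsub>F\<^esub> b"
    then show "b \<rightarrow>\<^bsub>F\<^esub> a" using arcs_ends_symmetric sym_arcs by metis
  next
    fix a b c assume E: "a \<rightarrow>\<^bsub>F\<^esub> b" "b \<rightarrow>\<^bsub>F\<^esub> c" "c \<rightarrow>\<^bsub>F\<^esub> a"
    obtain e where "e \<in> arcs F" "tail F e = a" "head F e = b" using E(1) by (rule reachableE)
    moreover obtain f where "f \<in> arcs F" "tail F f = b" "head F f = c" using E(2) by (rule reachableE)
    moreover obtain g where "g \<in> arcs F" "tail F g = c" "head F g = a" using E(3) by (rule reachableE)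
    moreover have "a \<noteq> b" "b \<noteq> c" "c \<noteq> a" using E adj_not_same by blast+
    ultimately have "cycle [e, f, g]"
      unfolding cycle_def by (intro exI[of _ a]) (auto simp: awalk_def)
    then show False using acyclic[of "[e, f, g]"] by simp
  next
    fix a b c d assume E: "a \<rightarrow>\<^bsub>F\<^esub> b" "b \<rightarrow>\<^bsub>F\<^esub> c" "c \<rightarrow>\<^bsub>F\<^esub> d" "d \<rightarrow>\<^bsub>F\<^esub> a" "a \<noteq> c" "b \<noteq> d"
    obtain e where "e \<in> arcs F" "tail F e = a" "head F e = b" using E(1) by (rule reachableE)
    moreover obtain f where "f \<in> arcs F" "tail F f = b" "head F f = c" using E(2) by (rule reachableE)
    moreover obtain g where "g \<in> arcs F" "tail F g = c" "head F g = d" using E(3) by (rule reachableE)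
    moreover obtain h where "h \<in> arcs F" "tail F h = d" "head F h = a" using E(4) by (rule reachableE)
    moreover have "a \<noteq> b" "b \<noteq> c" "c \<noteq> d" "d \<noteq> a" using E adj_not_same by blast+
    ultimately have "cycle [e, f, g, h]"
      unfolding cycle_def using E(5,6) by (intro exI[of _ a]) (auto simp: awalk_def)
    then show False using acyclic[of "[e, f, g, h]"] by simp
  qed
qed

lemma (in wf_digraph) graph_size_eq_card_edges:
  "graph_size G = card (edges (dominates G) (verts G))"
proof -
  have "(\<lambda>e. {tail G e, head G e}) ` arcs G = edges (dominates G) (verts G)"
    unfolding edges_def arcs_ends_conv by (force simp: image_iff)
  then show ?thesis by (simp add: graph_size_def)
qed

text \<open>Without parallel arcs, an out-arc of \<open>v\<close> is determined by its head.\<close>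
lemma (in nomulti_digraph) out_degree_delete_verts:
  assumes "v \<in> verts G - X"
  shows "out_degree (delete_verts G X) v = card (nbrs (dominates G) (verts G - X) v)"
proof -
  let ?A = "out_arcs (delete_verts G X) v"
  have A: "?A = {e \<in> arcs G. tail G e = v \<and> head G e \<in> verts G - X}"
    using assms by (auto simp: out_arcs_def delete_verts_def)
  have "inj_on (head G) ?A"
    unfolding A using no_multi_arcs by (auto simp: inj_on_def arc_to_ends_def)
  moreover have "head G ` ?A = nbrs (dominates G) (verts G - X) v"
    unfolding A by (auto simp: nbrs_def arcs_ends_conv image_iff)
  ultimately show ?thesis
    unfolding out_degree_def by (metis card_image)
qed

lemma (in digraph) f_num_2_le_if_tied:
  assumes "X \<subseteq> verts G" "tied (dominates G) (verts G - X)"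
  shows "f_num 2 G \<le> card X"
proof -
  let ?D = "delete_verts G X"
  have V: "verts ?D = verts G - X" by (auto simp: delete_verts_def)
  have "2 \<le> card (max_degree_verts ?D) \<or> card (verts ?D) < 2"
  proof (cases "card (verts G - X) < 2")
    case False
    then obtain u v where uv: "u \<in> verts ?D" "v \<in> verts ?D" "u \<noteq> v"
        "out_degree ?D u = out_degree ?D v"
        "\<And>w. w \<in> verts ?D \<Longrightarrow> out_degree ?D w \<le> out_degree ?D u"
      using assms(2) out_degree_delete_verts[of _ X] unfolding tied_def V by metis
    have "max_degree ?D = out_degree ?D u"
      unfolding max_degree_def using uv by (intro Max_eqI) (auto simp: V)
    then have "{u, v} \<subseteq> max_degree_verts ?D"
      using uv by (auto simp: max_degree_verts_def)
    moreover have "finite (max_degree_verts ?D)"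
      by (auto simp: max_degree_verts_def V)
    ultimately have "card {u, v} \<le> card (max_degree_verts ?D)" by (rule card_mono[rotated])
    then show ?thesis using uv(3) by simp
  qed (simp add: V)
  then show ?thesis
    unfolding f_num_def using assms(1) by (intro Least_le) blast
qed

theorem theorem2p2:
  fixes F :: "('a, 'b) pre_digraph" and t :: nat
  assumes "t > 0"
    and "undirected_forest F"
    and "real (graph_size F) < 1 / 6 * (real t ^ 3 + 6 * real t ^ 2 + 17 * real t + 12)"
  shows "f_num 2 F \<le> t"
proof (rule ccontr)
  assume large: "\<not> f_num 2 F \<le> t"
  interpret graph F using assms(2) by (simp add: undirected_forest_def)
  interpret no_short_cycles "dominates F"
    using assms(2) by (rule undirected_forest_no_short_cycles)
  have "\<not> tied (dominates F) (verts F - X)" if "X \<subseteq> verts F" "card X \<le> t" for X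
    using large f_num_2_le_if_tied[OF that(1)] that(2) by auto
  then have "(t + 3 choose 3) + t + 1 \<le> graph_size F"
    using degree_and_edges_of_hard_to_tie[of "verts F" t] by (auto simp: graph_size_eq_card_edges)
  then show False
    using assms(3) choose_bound_eq[of t] by linarith
qed

end
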